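(* Let $P=(\varphi_n)_{n=0}^\infty$ be a fixed sequence of functions as in the context, and let $(x_n)_{n=1}^\infty$ be a sequence of numbers from $(0,1)\setminus IS^{P^-}$. Then $$\lim_{n\to\infty}x_n=0\iff\lim_{n\to\infty}q_1(x_n)=\infty.$$
   Context: $\mathbb{N}=\{1,2,3,\ldots\}$. Fix a sequence $P=(\varphi_n)_{n=0}^\infty$, where $\varphi_0\in\mathbb{N}$ is a constant and, for $n\ge 1$, $\varphi_n\colon\mathbb{N}^n\to\mathbb{N}$ is an arbitrary function. The $P^-$-representation (alternating Perron expansion) of $x\in(0,1]$ is an expansion $$x=\sum_{n=0}^{\infty}\frac{(-1)^n r_0 r_1\cdots r_n}{(q_1-1)q_1\cdots(q_n-1)q_n\,(q_{n+1}-1)},$$ where $q_1,q_2,\ldots\in\mathbb{N}$, $r_0=\varphi_0$, $r_n=\varphi_n(q_1,\ldots,q_n)$ and $q_n\ge r_{n-1}+1$ for all $n\in\mathbb{N}$ (the $n=0$ term is $r_0/(q_1-1)$). $IS^{P^-}\subset(0,1]$ denotes the set of numbers in $(0,1]$ that have no $P^-$-representation; it is known to be countably infinite. It is known that every $x\in(0,1)\setminus IS^{P^-}$ has a unique $P^-$-representation; the number $q_n=q_n(x)$ is called the $n$th $P^-$-digit of $x$. *)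

theory Defs
  imports Complex_Main
begin

text \<open>
  The set of positive integers is rendered as the positive elements of \<^typ>\<open>nat\<close>. A function
  of \<open>n\<close> variables is applied to a list of length \<open>n\<close>; the values of \<open>\<phi> n\<close> on lists of another length,
  or on lists with an entry \<open>0\<close>, are unconstrained and never used.
\<close>

definition perron_functions :: "(nat \<Rightarrow> nat list \<Rightarrow> nat) \<Rightarrow> bool" where
  "perron_functions \<phi> \<longleftrightarrow>
     (\<forall>n qs. length qs = n \<longrightarrow> (\<forall>q\<in>set qs. q \<ge> 1) \<longrightarrow> \<phi> n qs \<ge> 1)"

text \<open>Digit sequences \<open>q\<close> are indexed from \<open>1\<close>; the value \<open>q 0\<close> plays no role.\<close>

definition perron_r :: "(nat \<Rightarrow> nat list \<Rightarrow> nat) \<Rightarrow> (nat \<Rightarrow> nat) \<Rightarrow> nat \<Rightarrow> nat" where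
  "perron_r \<phi> q n = \<phi> n (map q [1..<Suc n])"

definition perron_term :: "(nat \<Rightarrow> nat list \<Rightarrow> nat) \<Rightarrow> (nat \<Rightarrow> nat) \<Rightarrow> nat \<Rightarrow> real" where
  "perron_term \<phi> q n =
     (-1) ^ n * (\<Prod>i=0..n. real (perron_r \<phi> q i)) /
     ((\<Prod>i=1..n. (real (q i) - 1) * real (q i)) * (real (q (n + 1)) - 1))"

definition is_perron_rep :: "(nat \<Rightarrow> nat list \<Rightarrow> nat) \<Rightarrow> (nat \<Rightarrow> nat) \<Rightarrow> real \<Rightarrow> bool" where
  "is_perron_rep \<phi> q x \<longleftrightarrow>
     (\<forall>n\<ge>1. q n \<ge> 1 \<and> q n \<ge> perron_r \<phi> q (n - 1) + 1) \<and> perron_term \<phi> q sums x"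

definition perron_IS :: "(nat \<Rightarrow> nat list \<Rightarrow> nat) \<Rightarrow> real set" where
  "perron_IS \<phi> = {x \<in> {0<..1}. \<not> (\<exists>q. is_perron_rep \<phi> q x)}"

text \<open>
  The condition \<open>q 0 = 0\<close> normalises the irrelevant value, so that uniqueness of the
  representation is uniqueness of the function \<open>q\<close>.
\<close>

definition perron_digit :: "(nat \<Rightarrow> nat list \<Rightarrow> nat) \<Rightarrow> real \<Rightarrow> nat \<Rightarrow> nat" where
  "perron_digit \<phi> x = (THE q. q 0 = 0 \<and> is_perron_rep \<phi> q x)"

end

theory Submission
  imports Defs
begin

text \<open>
  The first digit pins down the order of magnitude of \<open>x\<close>. Splitting off the leading term of the
  expansion gives
  \[ x = \frac{r_0}{q_1-1} - \frac{r_0}{(q_1-1)q_1}\, y, \]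
  where \<open>y\<close> is again represented by a Perron expansion, with digits \<open>q\<^sub>2, q\<^sub>3, \<dots>\<close> and with the
  functions obtained by fixing \<open>q\<^sub>1\<close> as the first argument (\<open>perron_rep_tail\<close>). The absolute values
  of the terms of an expansion start at no more than \<open>1\<close> and at least halve at each step, so every
  expansion has its sum in the open interval \<open>(0,1)\<close> (\<open>perron_rep_in_unit_interval\<close>). Applied to
  \<open>y\<close> this yields \<open>r\<^sub>0/q\<^sub>1 < x < r\<^sub>0/(q\<^sub>1 - 1)\<close> (\<open>perron_rep_first_digit_bounds\<close>), and as
  \<open>r\<^sub>0\<close> is a constant, \<open>x\<close> is small exactly when \<open>q\<^sub>1\<close> is large.

  Since digits are defined by a definite description, uniqueness of the expansion
  is needed as well. It follows from the same two facts: these bounds determine \<open>q\<^sub>1\<close> from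
  \<open>x\<close>, then \<open>y\<close> is determined, and one continues with the expansion of \<open>y\<close>.
\<close>

section \<open>Splitting off the first digit\<close>

definition fix_first_digit :: "nat \<Rightarrow> (nat \<Rightarrow> nat list \<Rightarrow> nat) \<Rightarrow> nat \<Rightarrow> nat list \<Rightarrow> nat" where
  "fix_first_digit a \<phi> n qs = \<phi> (Suc n) (a # qs)"

lemma perron_functions_fix_first_digit:
  assumes "perron_functions \<phi>" "a \<ge> 1"
  shows "perron_functions (fix_first_digit a \<phi>)"
  unfolding perron_functions_def fix_first_digit_def
proof (intro allI impI)
  fix n and qs :: "nat list" assume "length qs = n" "\<forall>q\<in>set qs. q \<ge> 1"
  then have "length (a # qs) = Suc n" "\<forall>q\<in>set (a # qs). q \<ge> 1"
    using assms(2) by auto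
  then show "\<phi> (Suc n) (a # qs) \<ge> 1"
    using assms(1) unfolding perron_functions_def by blast
qed

lemma perron_r_Suc:
  "perron_r \<phi> q (Suc n) = perron_r (fix_first_digit (q 1) \<phi>) (\<lambda>k. q (Suc k)) n"
proof -
  have "map q [1..<Suc (Suc n)] = q 1 # map q [Suc 1..<Suc (Suc n)]"
    by (simp add: upt_rec)
  also have "map q [Suc 1..<Suc (Suc n)] = map (\<lambda>k. q (Suc k)) [1..<Suc n]"
    unfolding map_Suc_upt[symmetric] by (simp add: comp_def del: upt_Suc)
  finally show ?thesis
    by (simp add: perron_r_def fix_first_digit_def del: upt_Suc)
qed

lemma perron_term_0: "perron_term \<phi> q 0 = real (perron_r \<phi> q 0) / (real (q 1) - 1)"
  by (simp add: perron_term_def)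

lemma perron_term_Suc:
  "perron_term \<phi> q (Suc n) =
     - (real (perron_r \<phi> q 0) / ((real (q 1) - 1) * real (q 1))) *
     perron_term (fix_first_digit (q 1) \<phi>) (\<lambda>k. q (Suc k)) n"
proof -
  have "(\<Prod>i=0..Suc n. real (perron_r \<phi> q i)) =
      real (perron_r \<phi> q 0) * (\<Prod>i=0..n. real (perron_r \<phi> q (Suc i)))"
    by (simp only: prod.atLeast0_atMost_Suc_shift comp_def)
  moreover have "(\<Prod>i=1..Suc n. (real (q i) - 1) * real (q i)) =
      (real (q 1) - 1) * real (q 1) * (\<Prod>i=1..n. (real (q (Suc i)) - 1) * real (q (Suc i)))"
    by (subst prod.atLeast_Suc_atMost) (simp_all add: prod.shift_bounds_cl_Suc_ivl del: prod.cl_ivl_Suc)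
  ultimately show ?thesis
    unfolding perron_term_def by (simp add: perron_r_Suc mult_ac)
qed

lemma perron_r_pos:
  assumes "perron_functions \<phi>" "\<And>n. n \<ge> 1 \<Longrightarrow> q n \<ge> 1"
  shows "perron_r \<phi> q n \<ge> 1"
proof -
  have "\<forall>a\<in>set (map q [1..<Suc n]). a \<ge> 1"
    using assms(2) by (auto simp del: upt_Suc)
  then show ?thesis
    using assms(1) unfolding perron_functions_def perron_r_def
    by (metis diff_Suc_1 length_map length_upt)
qed

lemma perron_rep_digit:
  assumes "is_perron_rep \<phi> q x"
  shows "q (Suc n) \<ge> 1" "q (Suc n) \<ge> perron_r \<phi> q n + 1"
  using assms unfolding is_perron_rep_def by (metis Suc_eq_plus1 diff_Suc_1 le_add2)+

lemma perron_rep_r_pos: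
  assumes "perron_functions \<phi>" "is_perron_rep \<phi> q x"
  shows "perron_r \<phi> q n \<ge> 1"
  using assms by (intro perron_r_pos) (auto simp: is_perron_rep_def)

lemma perron_rep_tail:
  assumes "perron_functions \<phi>" "is_perron_rep \<phi> q x"
  obtains y where "is_perron_rep (fix_first_digit (q 1) \<phi>) (\<lambda>k. q (Suc k)) y"
    and "x = real (perron_r \<phi> q 0) / (real (q 1) - 1)
           - real (perron_r \<phi> q 0) / ((real (q 1) - 1) * real (q 1)) * y"
proof -
  define c where "c = real (perron_r \<phi> q 0) / ((real (q 1) - 1) * real (q 1))"
  define t where "t = perron_term (fix_first_digit (q 1) \<phi>) (\<lambda>k. q (Suc k))"
  have c: "c > 0"
    using perron_rep_r_pos[OF assms, of 0] perron_rep_digit(2)[OF assms(2), of 0]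
    by (auto simp: c_def intro!: divide_pos_pos mult_pos_pos)
  have "perron_term \<phi> q sums x"
    using assms(2) by (simp add: is_perron_rep_def)
  then have "(\<lambda>n. perron_term \<phi> q (Suc n)) sums (x - perron_term \<phi> q 0)"
    by (subst sums_Suc_iff) simp
  then have "(\<lambda>n. - c * t n) sums (x - perron_term \<phi> q 0)"
    by (simp only: perron_term_Suc c_def t_def)
  then have "(\<lambda>n. - (1 / c) * (- c * t n)) sums (- (1 / c) * (x - perron_term \<phi> q 0))"
    by (rule sums_mult)
  then have sums: "t sums (- (1 / c) * (x - perron_term \<phi> q 0))"
    using c by simp
  have "q (Suc n) \<ge> 1 \<and> q (Suc n) \<ge> perron_r (fix_first_digit (q 1) \<phi>) (\<lambda>k. q (Suc k)) (n - 1) + 1"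
    if "n \<ge> 1" for n
  proof -
    from that obtain m where "n = Suc m" by (cases n) auto
    then show ?thesis
      using perron_rep_digit[OF assms(2), of "Suc m"] by (simp add: perron_r_Suc)
  qed
  then have "is_perron_rep (fix_first_digit (q 1) \<phi>) (\<lambda>k. q (Suc k))
      (- (1 / c) * (x - perron_term \<phi> q 0))"
    using sums by (simp add: is_perron_rep_def t_def)
  moreover have "x = perron_term \<phi> q 0 - c * (- (1 / c) * (x - perron_term \<phi> q 0))"
    using c by simp
  ultimately show ?thesis
    using that unfolding perron_term_0 c_def by blast
qed

section \<open>Bounds on the sum and on the first digit\<close>

text \<open>
  The quotient of consecutive terms is \<open>r\<^sub>n\<^sub>+\<^sub>1 / (q\<^sub>n\<^sub>+\<^sub>1 (q\<^sub>n\<^sub>+\<^sub>2 - 1))\<close> in absolute value. Here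
  \<open>q\<^sub>n\<^sub>+\<^sub>2 - 1 \<ge> r\<^sub>n\<^sub>+\<^sub>1\<close>, so the quotient is at most \<open>1 / q\<^sub>n\<^sub>+\<^sub>1\<close>, and \<open>q\<^sub>n\<^sub>+\<^sub>1 \<ge> r\<^sub>n + 1 \<ge> 2\<close>.
\<close>

lemma perron_rep_abs_term_halves:
  assumes "perron_functions \<phi>" "is_perron_rep \<phi> q x"
  shows "\<bar>perron_term \<phi> q n\<bar> > 0" "\<bar>perron_term \<phi> q (Suc n)\<bar> \<le> \<bar>perron_term \<phi> q n\<bar> / 2"
proof -
  define A where "A = (\<Prod>i=0..n. real (perron_r \<phi> q i))"
  define B where "B = (\<Prod>i=1..n. (real (q i) - 1) * real (q i))"
  define r where "r = real (perron_r \<phi> q (Suc n))"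
  define u where "u = real (q (Suc n))"
  define v where "v = real (q (Suc (Suc n)))"
  have q2: "real (q i) \<ge> 2" if "i \<ge> 1" for i
    using that perron_rep_digit(2)[OF assms(2), of "i - 1"] perron_rep_r_pos[OF assms, of "i - 1"]
    by simp
  have A: "A > 0"
    unfolding A_def by (intro prod_pos) (use perron_rep_r_pos[OF assms] in \<open>auto simp: Suc_le_eq\<close>)
  have B: "B > 0"
    unfolding B_def
  proof (intro prod_pos ballI)
    fix i assume "i \<in> {1..n}"
    then show "(real (q i) - 1) * real (q i) > 0"
      using q2[of i] by simp
  qed
  have r: "r \<ge> 1" using perron_rep_r_pos[OF assms, of "Suc n"] by (simp add: r_def)
  have u: "u \<ge> 2" using q2[of "Suc n"] by (simp add: u_def)
  have v: "v - 1 \<ge> r"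
    using perron_rep_digit(2)[OF assms(2), of "Suc n"] by (simp add: v_def r_def)
  have "perron_term \<phi> q n = (-1) ^ n * A / (B * (u - 1))"
    by (simp add: perron_term_def A_def B_def u_def)
  then have t: "\<bar>perron_term \<phi> q n\<bar> = A / (B * (u - 1))"
    using A B u by (simp add: abs_mult)
  have "perron_term \<phi> q (Suc n) = (-1) ^ Suc n * (A * r) / (B * ((u - 1) * u) * (v - 1))"
    by (simp add: perron_term_def A_def B_def u_def v_def r_def)
  then have tS: "\<bar>perron_term \<phi> q (Suc n)\<bar> = A / (B * (u - 1)) * (r / (u * (v - 1)))"
    using A B u v r by (simp add: abs_mult)
  show "\<bar>perron_term \<phi> q n\<bar> > 0"
    unfolding t using A B u by simp
  have "2 * r \<le> u * (v - 1)"
    by (rule mult_mono) (use u v r in auto)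
  then have "r / (u * (v - 1)) \<le> 1 / 2"
    using u v r by (simp add: divide_simps)
  then have "A / (B * (u - 1)) * (r / (u * (v - 1))) \<le> A / (B * (u - 1)) * (1 / 2)"
    by (rule mult_left_mono) (use A B u in simp)
  then show "\<bar>perron_term \<phi> q (Suc n)\<bar> \<le> \<bar>perron_term \<phi> q n\<bar> / 2"
    unfolding t tS by simp
qed

text \<open>
  With \<open>a\<^sub>n\<close> the absolute values of the terms, the Leibniz estimates give
  \<open>a\<^sub>0 - a\<^sub>1 \<le> x \<le> a\<^sub>0 - a\<^sub>1 + a\<^sub>2\<close>. The halving of the terms makes both resulting bounds strict;
  strictness is what later leaves a single candidate for the first digit.
\<close>

lemma perron_rep_in_unit_interval:
  assumes "perron_functions \<phi>" "is_perron_rep \<phi> q x"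
  shows "0 < x" "x < 1"
proof -
  define a where "a n = \<bar>perron_term \<phi> q n\<bar>" for n
  have pos: "a n > 0" and half: "a (Suc n) \<le> a n / 2" for n
    using perron_rep_abs_term_halves[OF assms] by (simp_all add: a_def)
  have sign: "perron_term \<phi> q n = (-1) ^ n * a n" for n
  proof -
    define c where "c = (\<Prod>i=0..n. real (perron_r \<phi> q i)) /
      ((\<Prod>i=1..n. (real (q i) - 1) * real (q i)) * (real (q (n + 1)) - 1))"
    have "c \<ge> 0"
      unfolding c_def
    proof (intro divide_nonneg_nonneg mult_nonneg_nonneg prod_nonneg ballI)
      show "0 \<le> real (q (n + 1)) - 1"
        using perron_rep_digit(1)[OF assms(2), of n] by simp
      fix i assume "i \<in> {1..n}"
      then show "0 \<le> real (q i) - 1"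
        using perron_rep_digit(1)[OF assms(2), of "i - 1"] by simp
    qed auto
    moreover have "perron_term \<phi> q n = (-1) ^ n * c"
      by (simp add: perron_term_def c_def)
    ultimately show ?thesis
      by (simp add: a_def abs_mult)
  qed
  have sums: "(\<lambda>n. (-1) ^ n * a n) sums x"
    using assms(2) unfolding is_perron_rep_def sign[symmetric] by blast
  have "perron_term \<phi> q \<longlonglongrightarrow> 0"
    using assms(2) unfolding is_perron_rep_def by (blast intro: summable_LIMSEQ_zero sums_summable)
  then have lim: "a \<longlonglongrightarrow> 0"
    unfolding a_def by (rule tendsto_rabs_zero)
  have nonneg: "0 \<le> a n" and dec: "a (Suc n) \<le> a n" for n
    using pos[of n] half[of n] by simp_all
  note leibniz = summable_Leibniz'[OF lim nonneg dec]
  have "(\<Sum>i<2 * 1. (-1) ^ i * a i) \<le> x"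
    using leibniz(2)[of 1] sums_unique[OF sums] by simp
  then have "a 0 - a 1 \<le> x"
    by (simp add: numeral_2_eq_2)
  then show "0 < x"
    using half[of 0] pos[of 0] by simp
  have "x \<le> (\<Sum>i<2 * 1 + 1. (-1) ^ i * a i)"
    using leibniz(4)[of 1] sums_unique[OF sums] by simp
  then have "x \<le> a 0 - a 1 + a 2"
    by (simp add: numeral_2_eq_2)
  moreover have "a 2 < a 1"
    using half[of 1] pos[of 1] by (simp add: numeral_2_eq_2)
  moreover have "a 0 \<le> 1"
    using perron_rep_digit(2)[OF assms(2), of 0] perron_rep_r_pos[OF assms, of 0]
    by (simp add: a_def perron_term_0)
  ultimately show "x < 1"
    by simp
qed

lemma perron_rep_first_digit_bounds:
  assumes "perron_functions \<phi>" "is_perron_rep \<phi> q x"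
  shows "real (perron_r \<phi> q 0) / real (q 1) < x"
    and "x < real (perron_r \<phi> q 0) / (real (q 1) - 1)"
proof -
  define r where "r = real (perron_r \<phi> q 0)"
  define d where "d = real (q 1)"
  have r: "r > 0" and d: "d > 1"
    using perron_rep_digit(2)[OF assms(2), of 0] perron_rep_r_pos[OF assms, of 0]
    by (simp_all add: r_def d_def)
  obtain y where rep: "is_perron_rep (fix_first_digit (q 1) \<phi>) (\<lambda>k. q (Suc k)) y"
    and x: "x = r / (d - 1) - r / ((d - 1) * d) * y"
    using perron_rep_tail[OF assms] unfolding r_def d_def by blast
  have "perron_functions (fix_first_digit (q 1) \<phi>)"
    using perron_functions_fix_first_digit[OF assms(1)] d by (simp add: d_def)
  from perron_rep_in_unit_interval[OF this rep] have y: "0 < y" "y < 1" .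
  have c: "r / ((d - 1) * d) > 0"
    using r d by simp
  then have "r / ((d - 1) * d) * y < r / ((d - 1) * d) * 1"
    by (rule mult_strict_left_mono[OF y(2)])
  moreover have "r / (d - 1) - r / ((d - 1) * d) = r / d"
    using d by (simp add: divide_simps) (simp add: algebra_simps)
  ultimately show "real (perron_r \<phi> q 0) / real (q 1) < x"
    unfolding x r_def[symmetric] d_def[symmetric] by simp
  show "x < real (perron_r \<phi> q 0) / (real (q 1) - 1)"
    unfolding x r_def[symmetric] d_def[symmetric] using mult_pos_pos[OF c y(1)] by simp
qed

section \<open>Uniqueness of the expansion\<close>

text \<open>\<open>r\<^sub>0\<close> depends on no digit, so both expansions below have the same \<open>r\<^sub>0\<close>.\<close>

lemma perron_rep_first_digit_unique:
  assumes "perron_functions \<phi>" "is_perron_rep \<phi> q x" "is_perron_rep \<phi> q' x"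
  shows "q 1 = q' 1"
proof -
  \<comment> \<open>The bounds say \<open>q\<^sub>1 - 1 < r\<^sub>0 / x < q\<^sub>1\<close>, which holds for one integer only.\<close>
  have digit: "real (p 1) - 1 < \<phi> 0 [] / x \<and> \<phi> 0 [] / x < real (p 1)"
    if "is_perron_rep \<phi> p x" for p
  proof -
    have "perron_r \<phi> p 0 = \<phi> 0 []"
      by (simp add: perron_r_def)
    moreover have "real (p 1) > 1"
      using perron_rep_digit(2)[OF that, of 0] perron_rep_r_pos[OF assms(1) that, of 0] by simp
    ultimately show ?thesis
      using perron_rep_first_digit_bounds[OF assms(1) that]
        perron_rep_in_unit_interval[OF assms(1) that]
      by (simp add: field_simps)
  qed
  show ?thesis
    using digit[OF assms(2)] digit[OF assms(3)] by linarith
qed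

lemma perron_rep_unique:
  assumes "perron_functions \<phi>" "is_perron_rep \<phi> q x" "is_perron_rep \<phi> q' x"
  shows "q (Suc n) = q' (Suc n)"
  using assms
proof (induction n arbitrary: \<phi> q q' x)
  case 0
  then show ?case
    using perron_rep_first_digit_unique by simp
next
  case (Suc n)
  define r where "r = real (\<phi> 0 [])"
  define d where "d = real (q 1)"
  have eq: "q' 1 = q 1"
    using perron_rep_first_digit_unique Suc.prems by metis
  have r0: "perron_r \<phi> q 0 = \<phi> 0 []" "perron_r \<phi> q' 0 = \<phi> 0 []"
    by (simp_all add: perron_r_def)
  have r: "r > 0" and d: "d > 1"
    using perron_rep_digit(2)[OF Suc.prems(2), of 0] perron_rep_r_pos[OF Suc.prems(1,2), of 0]
    by (simp_all add: r_def d_def r0)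
  obtain y where y: "is_perron_rep (fix_first_digit (q 1) \<phi>) (\<lambda>k. q (Suc k)) y"
    and xy: "x = r / (d - 1) - r / ((d - 1) * d) * y"
    using perron_rep_tail[OF Suc.prems(1,2)] unfolding r_def d_def r0 by blast
  obtain y' where y': "is_perron_rep (fix_first_digit (q 1) \<phi>) (\<lambda>k. q' (Suc k)) y'"
    and xy': "x = r / (d - 1) - r / ((d - 1) * d) * y'"
    using perron_rep_tail[OF Suc.prems(1,3)] unfolding r_def d_def r0 eq by blast
  have "r / ((d - 1) * d) * y = r / ((d - 1) * d) * y'"
    using xy xy' by linarith
  then have "y' = y"
    using r d by simp
  moreover have "perron_functions (fix_first_digit (q 1) \<phi>)"
    using perron_functions_fix_first_digit[OF Suc.prems(1)] d by (simp add: d_def)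
  ultimately show ?case
    using Suc.IH[of "fix_first_digit (q 1) \<phi>" "\<lambda>k. q (Suc k)" y "\<lambda>k. q' (Suc k)"] y y' by simp
qed

text \<open>
  No term of the expansion involves \<open>q 0\<close>, so any representation can be brought into the
  normal form that \<^const>\<open>perron_digit\<close> selects.
\<close>

lemma is_perron_rep_update_0: "is_perron_rep \<phi> (q(0 := a)) x \<longleftrightarrow> is_perron_rep \<phi> q x"
proof -
  have r: "perron_r \<phi> (q(0 := a)) n = perron_r \<phi> q n" for n
    by (simp add: perron_r_def del: upt_Suc)
  have "perron_term \<phi> (q(0 := a)) n = perron_term \<phi> q n" for n
    unfolding perron_term_def r by simp
  then show ?thesis
    by (simp add: is_perron_rep_def r cong: sums_cong)
qed

lemma is_perron_rep_perron_digit: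
  assumes "perron_functions \<phi>" "x \<in> {0<..<1} - perron_IS \<phi>"
  shows "is_perron_rep \<phi> (perron_digit \<phi> x) x"
proof -
  obtain q where "is_perron_rep \<phi> q x"
    using assms(2) by (auto simp: perron_IS_def)
  then have q: "is_perron_rep \<phi> (q(0 := 0)) x"
    by (simp add: is_perron_rep_update_0)
  have "\<exists>!q. q 0 = 0 \<and> is_perron_rep \<phi> q x"
  proof (rule ex1I[of _ "q(0 := 0)"])
    show "(q(0 := 0)) 0 = 0 \<and> is_perron_rep \<phi> (q(0 := 0)) x"
      using q by simp
    fix p assume p: "p 0 = 0 \<and> is_perron_rep \<phi> p x"
    show "p = q(0 := 0)"
    proof
      fix n
      show "p n = (q(0 := 0)) n"
        using p perron_rep_unique[OF assms(1) _ q, of p] by (cases n) auto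
    qed
  qed
  from theI'[OF this] show ?thesis
    by (simp add: perron_digit_def)
qed

section \<open>Small numbers and large first digits\<close>

theorem proposition7:
  fixes \<phi> :: "nat \<Rightarrow> nat list \<Rightarrow> nat" and x :: "nat \<Rightarrow> real"
  assumes "perron_functions \<phi>"
    and "\<And>n. n \<ge> 1 \<Longrightarrow> x n \<in> {0<..<1} - perron_IS \<phi>"
  shows "x \<longlonglongrightarrow> 0 \<longleftrightarrow>
         filterlim (\<lambda>n. perron_digit \<phi> (x n) 1) at_top sequentially"
proof -
  define r where "r = real (\<phi> 0 [])"
  define d where "d n = perron_digit \<phi> (x n) 1" for n
  have r: "r > 0"
    using assms(1)[unfolded perron_functions_def, rule_format, of "[]" 0] by (simp add: r_def)
  have bounds: "r / d n < x n" "x n < r / (real (d n) - 1)" "real (d n) > 1" "x n > 0"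
    if "n \<ge> 1" for n
  proof -
    note rep = is_perron_rep_perron_digit[OF assms(1) assms(2)[OF that]]
    have r0: "real (perron_r \<phi> (perron_digit \<phi> (x n)) 0) = r"
      by (simp add: perron_r_def r_def)
    show "r / d n < x n" "x n < r / (real (d n) - 1)"
      using perron_rep_first_digit_bounds[OF assms(1) rep] unfolding d_def r0 .
    show "real (d n) > 1"
      using perron_rep_digit(2)[OF rep, of 0] perron_rep_r_pos[OF assms(1) rep, of 0]
      by (simp add: d_def)
    show "x n > 0"
      using assms(2)[OF that] by simp
  qed
  have "x \<longlonglongrightarrow> 0 \<longleftrightarrow> filterlim (\<lambda>n. real (d n)) at_top sequentially"
  proof
    assume "x \<longlonglongrightarrow> 0"
    moreover have "\<forall>\<^sub>F n in sequentially. x n > 0"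
      using eventually_ge_at_top[of 1] by eventually_elim (rule bounds(4))
    ultimately have "filterlim x (at_right 0) sequentially"
      by (rule tendsto_imp_filterlim_at_right)
    then have "filterlim (\<lambda>n. r * inverse (x n)) at_top sequentially"
      by (intro filterlim_tendsto_pos_mult_at_top[OF tendsto_const r]
          filterlim_compose[OF filterlim_inverse_at_top_right])
    moreover have "\<forall>\<^sub>F n in sequentially. r * inverse (x n) \<le> real (d n)"
      using eventually_ge_at_top[of 1]
    proof eventually_elim
      case (elim n)
      then show ?case
        using bounds[of n] by (simp add: field_simps)
    qed
    ultimately show "filterlim (\<lambda>n. real (d n)) at_top sequentially"
      by (rule filterlim_at_top_mono)
  next
    assume "filterlim (\<lambda>n. real (d n)) at_top sequentially"
    then have "filterlim (\<lambda>n. -1 + real (d n)) at_top sequentially"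
      by (rule filterlim_tendsto_add_at_top[OF tendsto_const])
    then have "(\<lambda>n. r / (-1 + real (d n))) \<longlonglongrightarrow> 0"
      by (rule real_tendsto_divide_at_top[OF tendsto_const])
    then show "x \<longlonglongrightarrow> 0"
    proof (rule tendsto_sandwich[rotated 3])
      show "\<forall>\<^sub>F n in sequentially. 0 \<le> x n"
        using bounds(4) by (auto simp: eventually_sequentially intro: less_imp_le)
      show "\<forall>\<^sub>F n in sequentially. x n \<le> r / (-1 + real (d n))"
        using bounds(2) by (auto simp: eventually_sequentially intro!: exI[of _ 1] less_imp_le)
    qed simp
  qed
  also have "\<dots> \<longleftrightarrow> filterlim d at_top sequentially"
    by (rule filterlim_sequentially_iff_filterlim_real[symmetric])
  finally show ?thesis
    by (simp add: d_def[abs_def])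
qed

end
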